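(* Let $R$ be a finite Frobenius ring with unity (not assumed commutative), let $n$ be a positive integer, and let $C$ and $D$ be two linear codes in $R^n$ (i.e. right $R$-submodules of $R^n$) such that $C\oplus D$ is closed in $R^n$. Then the following are equivalent: (1) the pair $(C,D)$ is LCP; (2) $C\oplus D$ is an essential submodule of $R^n$; (3) $0$ is a complement of $C\oplus D$ in $R^n$.
   Context: A finite ring $R$ is Frobenius if it is right and left self-injective and $R/J(R)\cong \mathrm{Soc}(R)$ as right $R$-modules, where $J(R)$ is the Jacobson radical. A linear code of length $n$ over $R$ is a right $R$-submodule of $R^n$. The pair $(C,D)$ is LCP (a linear complementary pair) if $C\oplus D=R^n$, i.e. $C+D=R^n$ and $C\cap D=\{0\}$. A right $R$-submodule $A$ of $R^n$ is essential if $A\cap M\neq 0$ for every nonzero right $R$-submodule $M$ of $R^n$. For right $R$-submodules $A,B$ of $R^n$, $B$ is a complement (submodule) of $A$ in $R^n$ if $B$ is maximal among right $R$-submodules of $R^n$ with respect to $A\cap B=\{0\}$. A right $R$-submodule of $R^n$ is closed in $R^n$ if it is the complement of some right $R$-submodule of $R^n$. Writing $C\oplus D$ means the internal direct sum, so it includes the assertion $C\cap D=\{0\}$. *)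

theory Defs
  imports "HOL-Algebra.Module" "HOL-Algebra.AbelCoset" "HOL-Algebra.Generated_Groups"
begin

section \<open>Right modules over a (not necessarily commutative) ring\<close>

text \<open>
  The locale \<^locale>\<open>module\<close> of the library is restricted to commutative rings.  We reuse its record
  type and its notion of submodule, but read \<open>r \<odot>\<^bsub>M\<^esub> x\<close> as the right action \<open>x r\<close>; this shows
  only in the axiom \<open>smult_assoc\<close>, which says \<open>x (r s) = (x r) s\<close>.  The fields \<^const>\<open>monoid.mult\<close> and
  \<^const>\<open>one\<close> of a module record carry no meaning and are left unspecified below.
\<close>

locale right_module = R?: ring R + M?: abelian_group M
  for R :: "('a, 'r) ring_scheme" (structure)
    and M :: "('a, 'b, 'm) module_scheme" (structure) +
  assumes smult_closed [simp, intro]: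
      "\<lbrakk>r \<in> carrier R; x \<in> carrier M\<rbrakk> \<Longrightarrow> r \<odot>\<^bsub>M\<^esub> x \<in> carrier M"
    and smult_l_distr:
      "\<lbrakk>r \<in> carrier R; s \<in> carrier R; x \<in> carrier M\<rbrakk> \<Longrightarrow>
        (r \<oplus>\<^bsub>R\<^esub> s) \<odot>\<^bsub>M\<^esub> x = r \<odot>\<^bsub>M\<^esub> x \<oplus>\<^bsub>M\<^esub> s \<odot>\<^bsub>M\<^esub> x"
    and smult_r_distr:
      "\<lbrakk>r \<in> carrier R; x \<in> carrier M; y \<in> carrier M\<rbrakk> \<Longrightarrow>
        r \<odot>\<^bsub>M\<^esub> (x \<oplus>\<^bsub>M\<^esub> y) = r \<odot>\<^bsub>M\<^esub> x \<oplus>\<^bsub>M\<^esub> r \<odot>\<^bsub>M\<^esub> y"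
    and smult_assoc:
      "\<lbrakk>r \<in> carrier R; s \<in> carrier R; x \<in> carrier M\<rbrakk> \<Longrightarrow>
        (r \<otimes>\<^bsub>R\<^esub> s) \<odot>\<^bsub>M\<^esub> x = s \<odot>\<^bsub>M\<^esub> (r \<odot>\<^bsub>M\<^esub> x)"
    and smult_one [simp]:
      "x \<in> carrier M \<Longrightarrow> \<one>\<^bsub>R\<^esub> \<odot>\<^bsub>M\<^esub> x = x"

definition regular_module :: "('a, 'm) ring_scheme \<Rightarrow> ('a, 'a) module" where
  "regular_module R =
    \<lparr>carrier = carrier R, monoid.mult = undefined, one = undefined,
     zero = \<zero>\<^bsub>R\<^esub>, add = add R, smult = (\<lambda>r x. x \<otimes>\<^bsub>R\<^esub> r)\<rparr>"

text \<open>\<open>R\<^sup>n\<close>: the vectors \<open>(x\<^sub>0, \<dots>, x\<^sub>n\<^sub>-\<^sub>1)\<close> are the extensional functions on \<open>{..<n}\<close>.\<close>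

definition free_module :: "('a, 'm) ring_scheme \<Rightarrow> nat \<Rightarrow> ('a, nat \<Rightarrow> 'a) module" where
  "free_module R n =
    \<lparr>carrier = {..<n} \<rightarrow>\<^sub>E carrier R, monoid.mult = undefined, one = undefined,
     zero = (\<lambda>i\<in>{..<n}. \<zero>\<^bsub>R\<^esub>),
     add = (\<lambda>x y. \<lambda>i\<in>{..<n}. x i \<oplus>\<^bsub>R\<^esub> y i),
     smult = (\<lambda>r x. \<lambda>i\<in>{..<n}. x i \<otimes>\<^bsub>R\<^esub> r)\<rparr>"

definition quotient_module ::
  "('a, 'b, 'm) module_scheme \<Rightarrow> 'b set \<Rightarrow> ('a, 'b set) module" where
  "quotient_module M N =
    \<lparr>carrier = a_rcosets\<^bsub>M\<^esub> N, monoid.mult = undefined, one = undefined,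
     zero = N, add = set_add M,
     smult = (\<lambda>r X. \<Union>x\<in>X. N +>\<^bsub>M\<^esub> (r \<odot>\<^bsub>M\<^esub> x))\<rparr>"

definition module_hom ::
  "('a, 'r) ring_scheme \<Rightarrow> ('a, 'b, 'm) module_scheme \<Rightarrow> ('a, 'c, 'k) module_scheme \<Rightarrow> ('b \<Rightarrow> 'c) set"
  where
  "module_hom R M N =
    {f \<in> carrier M \<rightarrow> carrier N.
      (\<forall>x\<in>carrier M. \<forall>y\<in>carrier M. f (x \<oplus>\<^bsub>M\<^esub> y) = f x \<oplus>\<^bsub>N\<^esub> f y) \<and>
      (\<forall>r\<in>carrier R. \<forall>x\<in>carrier M. f (r \<odot>\<^bsub>M\<^esub> x) = r \<odot>\<^bsub>N\<^esub> f x)}"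

definition module_iso ::
  "('a, 'r) ring_scheme \<Rightarrow> ('a, 'b, 'm) module_scheme \<Rightarrow> ('a, 'c, 'k) module_scheme \<Rightarrow> bool" where
  "module_iso R M N \<longleftrightarrow> (\<exists>f\<in>module_hom R M N. bij_betw f (carrier M) (carrier N))"


section \<open>Finite Frobenius rings\<close>

text \<open>
  Right ideals are the submodules of the regular module; for the zero ring, which has no maximal
  right ideal, the radical is the whole ring.
\<close>

definition maximal_right_ideal :: "('a, 'm) ring_scheme \<Rightarrow> 'a set \<Rightarrow> bool" where
  "maximal_right_ideal R I \<longleftrightarrow>
    submodule I R (regular_module R) \<and> I \<noteq> carrier R \<and>
    (\<forall>K. submodule K R (regular_module R) \<and> I \<subseteq> K \<longrightarrow> K = I \<or> K = carrier R)"

definition jacobson_radical :: "('a, 'm) ring_scheme \<Rightarrow> 'a set" where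
  "jacobson_radical R = {a \<in> carrier R. \<forall>I. maximal_right_ideal R I \<longrightarrow> a \<in> I}"

definition simple_submodule ::
  "('a, 'r) ring_scheme \<Rightarrow> ('a, 'b, 'm) module_scheme \<Rightarrow> 'b set \<Rightarrow> bool" where
  "simple_submodule R M S \<longleftrightarrow>
    submodule S R M \<and> S \<noteq> {\<zero>\<^bsub>M\<^esub>} \<and>
    (\<forall>K. submodule K R M \<and> K \<subseteq> S \<longrightarrow> K = {\<zero>\<^bsub>M\<^esub>} \<or> K = S)"

text \<open>The sum of a family of submodules is the additive subgroup generated by their union.\<close>

definition socle :: "('a, 'r) ring_scheme \<Rightarrow> ('a, 'b, 'm) module_scheme \<Rightarrow> 'b set" where
  "socle R M = generate (add_monoid M) (\<Union> {S. simple_submodule R M S})"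

text \<open>
  HOL cannot quantify over all modules of all types, so injectivity is relative to the type \<open>'u\<close>
  from which the elements of the test modules are drawn.  By Baer's criterion the elements of the
  ring itself already suffice; see \<open>injective_module_any_universe\<close> below.
\<close>

definition injective_module ::
  "'u itself \<Rightarrow> ('a, 'r) ring_scheme \<Rightarrow> ('a, 'b, 'm) module_scheme \<Rightarrow> bool" where
  "injective_module U R Q \<longleftrightarrow>
    right_module R Q \<and>
    (\<forall>(N :: ('a, 'u) module) M f.
      right_module R N \<and> submodule M R N \<and> f \<in> module_hom R (N\<lparr>carrier := M\<rparr>) Q \<longrightarrow>
      (\<exists>g\<in>module_hom R N Q. \<forall>x\<in>M. g x = f x))"

text \<open>Left modules over a ring are right modules over its opposite ring.\<close>

definition opposite_ring :: "('a, 'm) ring_scheme \<Rightarrow> ('a, 'm) ring_scheme" where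
  "opposite_ring R = R\<lparr>monoid.mult := \<lambda>x y. y \<otimes>\<^bsub>R\<^esub> x\<rparr>"

definition right_self_injective :: "('a, 'm) ring_scheme \<Rightarrow> bool" where
  "right_self_injective R \<longleftrightarrow> injective_module TYPE('a) R (regular_module R)"

definition left_self_injective :: "('a, 'm) ring_scheme \<Rightarrow> bool" where
  "left_self_injective R \<longleftrightarrow>
    injective_module TYPE('a) (opposite_ring R) (regular_module (opposite_ring R))"

definition finite_frobenius_ring :: "('a, 'm) ring_scheme \<Rightarrow> bool" where
  "finite_frobenius_ring R \<longleftrightarrow>
    ring R \<and> finite (carrier R) \<and> right_self_injective R \<and> left_self_injective R \<and>
    module_iso R (quotient_module (regular_module R) (jacobson_radical R))
      ((regular_module R)\<lparr>carrier := socle R (regular_module R)\<rparr>)"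


section \<open>Linear codes, essential and closed submodules\<close>

definition linear_code :: "('a, 'm) ring_scheme \<Rightarrow> nat \<Rightarrow> (nat \<Rightarrow> 'a) set \<Rightarrow> bool" where
  "linear_code R n C \<longleftrightarrow> submodule C R (free_module R n)"

definition independent_submodules :: "('a, 'b, 'm) module_scheme \<Rightarrow> 'b set \<Rightarrow> 'b set \<Rightarrow> bool" where
  "independent_submodules M A B \<longleftrightarrow> A \<inter> B = {\<zero>\<^bsub>M\<^esub>}"

definition LCP :: "('a, 'm) ring_scheme \<Rightarrow> nat \<Rightarrow> (nat \<Rightarrow> 'a) set \<Rightarrow> (nat \<Rightarrow> 'a) set \<Rightarrow> bool" where
  "LCP R n C D \<longleftrightarrow>
    C <+>\<^bsub>free_module R n\<^esub> D = carrier (free_module R n) \<and>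
    independent_submodules (free_module R n) C D"

definition essential_submodule ::
  "('a, 'r) ring_scheme \<Rightarrow> ('a, 'b, 'm) module_scheme \<Rightarrow> 'b set \<Rightarrow> bool" where
  "essential_submodule R M A \<longleftrightarrow>
    submodule A R M \<and>
    (\<forall>N. submodule N R M \<and> N \<noteq> {\<zero>\<^bsub>M\<^esub>} \<longrightarrow> A \<inter> N \<noteq> {\<zero>\<^bsub>M\<^esub>})"

text \<open>\<open>complement_submodule R M A B\<close>: \<open>B\<close> is a complement of \<open>A\<close> in \<open>M\<close>.\<close>

definition complement_submodule ::
  "('a, 'r) ring_scheme \<Rightarrow> ('a, 'b, 'm) module_scheme \<Rightarrow> 'b set \<Rightarrow> 'b set \<Rightarrow> bool" where
  "complement_submodule R M A B \<longleftrightarrow>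
    submodule A R M \<and> submodule B R M \<and> A \<inter> B = {\<zero>\<^bsub>M\<^esub>} \<and>
    (\<forall>N. submodule N R M \<and> A \<inter> N = {\<zero>\<^bsub>M\<^esub>} \<and> B \<subseteq> N \<longrightarrow> N = B)"

definition closed_submodule ::
  "('a, 'r) ring_scheme \<Rightarrow> ('a, 'b, 'm) module_scheme \<Rightarrow> 'b set \<Rightarrow> bool" where
  "closed_submodule R M A \<longleftrightarrow> (\<exists>B. submodule B R M \<and> complement_submodule R M B A)"


section \<open>The constructions are well-formed\<close>

lemma ring_opposite_ring:
  assumes "ring R"
  shows "ring (opposite_ring R)"
proof -
  interpret ring R by fact
  have 1: "x \<in> carrier R \<Longrightarrow> \<exists>y\<in>carrier R. y \<oplus>\<^bsub>R\<^esub> x = \<zero>\<^bsub>R\<^esub>" for x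
    using l_neg a_inv_closed by blast
  show ?thesis
    by (intro ringI abelian_groupI monoidI)
      (auto simp: opposite_ring_def a_assoc m_assoc l_distr r_distr a_ac 1)
qed

lemma right_module_regular_module:
  assumes "ring R"
  shows "right_module R (regular_module R)"
proof -
  interpret ring R by fact
  have 1: "x \<in> carrier R \<Longrightarrow> \<exists>y\<in>carrier R. y \<oplus>\<^bsub>R\<^esub> x = \<zero>\<^bsub>R\<^esub>" for x
    using l_neg a_inv_closed by blast
  show ?thesis
    by (intro right_module.intro right_module_axioms.intro abelian_groupI assms)
      (auto simp: regular_module_def a_assoc m_assoc l_distr r_distr a_ac 1)
qed

lemma right_module_free_module:
  assumes "ring R"
  shows "right_module R (free_module R n)"
proof -
  interpret ring R by fact
  have mem: "x i \<in> carrier R" if "x \<in> {..<n} \<rightarrow>\<^sub>E carrier R" "i < n" for x :: "nat \<Rightarrow> 'a" and i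
    using that by auto
  have clos: "restrict f {..<n} \<in> {..<n} \<rightarrow>\<^sub>E carrier R"
    if "\<And>i. i < n \<Longrightarrow> f i \<in> carrier R" for f
    using that by auto
  have restr: "restrict f {..<n} = x"
    if "x \<in> {..<n} \<rightarrow>\<^sub>E carrier R" "\<And>i. i < n \<Longrightarrow> f i = x i" for f x
    using that by (auto simp: PiE_def extensional_def restrict_def fun_eq_iff)
  have neg: "\<exists>y\<in>{..<n} \<rightarrow>\<^sub>E carrier R. (\<lambda>i\<in>{..<n}. y i \<oplus>\<^bsub>R\<^esub> x i) = (\<lambda>i\<in>{..<n}. \<zero>\<^bsub>R\<^esub>)"
    if x: "x \<in> {..<n} \<rightarrow>\<^sub>E carrier R" for x
  proof
    show "(\<lambda>i\<in>{..<n}. \<ominus>\<^bsub>R\<^esub> x i) \<in> {..<n} \<rightarrow>\<^sub>E carrier R"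
      using mem[OF x] by (intro clos) simp
    show "(\<lambda>i\<in>{..<n}. (\<lambda>i\<in>{..<n}. \<ominus>\<^bsub>R\<^esub> x i) i \<oplus>\<^bsub>R\<^esub> x i) = (\<lambda>i\<in>{..<n}. \<zero>\<^bsub>R\<^esub>)"
      using mem[OF x] by (intro restrict_ext) (simp add: l_neg)
  qed
  note sel = free_module_def partial_object.simps monoid.simps ring.simps module.simps
  have "abelian_group (free_module R n)"
  proof (rule abelian_groupI, unfold sel)
    fix x assume x: "x \<in> {..<n} \<rightarrow>\<^sub>E carrier R"
    show "\<exists>y\<in>{..<n} \<rightarrow>\<^sub>E carrier R. (\<lambda>i\<in>{..<n}. y i \<oplus>\<^bsub>R\<^esub> x i) = (\<lambda>i\<in>{..<n}. \<zero>\<^bsub>R\<^esub>)"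
      using x by (rule neg)
  qed (intro clos restr restrict_ext; simp add: mem a_ac)+
  then show ?thesis
  proof (intro right_module.intro right_module_axioms.intro assms, assumption)
  qed (unfold sel, (intro clos restr restrict_ext; simp add: mem l_distr r_distr m_assoc)+)
qed

context right_module
begin

lemma smult_l_null: "x \<in> carrier M \<Longrightarrow> \<zero>\<^bsub>R\<^esub> \<odot>\<^bsub>M\<^esub> x = \<zero>\<^bsub>M\<^esub>"
  by (metis M.add.r_cancel_one' R.add.one_closed R.add.r_one smult_closed smult_l_distr)

lemma smult_minus_one:
  assumes "x \<in> carrier M"
  shows "(\<ominus>\<^bsub>R\<^esub> \<one>\<^bsub>R\<^esub>) \<odot>\<^bsub>M\<^esub> x = \<ominus>\<^bsub>M\<^esub> x"
proof -
  have "(\<ominus>\<^bsub>R\<^esub> \<one>\<^bsub>R\<^esub>) \<odot>\<^bsub>M\<^esub> x \<oplus>\<^bsub>M\<^esub> x = \<zero>\<^bsub>M\<^esub>"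
    using assms smult_l_distr[of "\<ominus>\<^bsub>R\<^esub> \<one>\<^bsub>R\<^esub>" "\<one>\<^bsub>R\<^esub>" x] by (simp add: smult_l_null R.l_neg)
  then show ?thesis
    using assms by (metis M.minus_equality R.a_inv_closed R.one_closed smult_closed)
qed

lemma right_submoduleI:
  assumes "H \<subseteq> carrier M" "\<zero>\<^bsub>M\<^esub> \<in> H"
    and "\<And>x y. \<lbrakk>x \<in> H; y \<in> H\<rbrakk> \<Longrightarrow> x \<oplus>\<^bsub>M\<^esub> y \<in> H"
    and "\<And>r x. \<lbrakk>r \<in> carrier R; x \<in> H\<rbrakk> \<Longrightarrow> r \<odot>\<^bsub>M\<^esub> x \<in> H"
  shows "submodule H R M"
proof -
  have "\<ominus>\<^bsub>M\<^esub> x \<in> H" if "x \<in> H" for x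
    using that assms(1) assms(4)[of "\<ominus>\<^bsub>R\<^esub> \<one>\<^bsub>R\<^esub>" x] smult_minus_one by auto
  then show ?thesis
    using assms by (intro submodule.intro subgroup.intro submodule_axioms.intro)
      (auto simp: a_inv_def)
qed

end

text \<open>Baer's criterion: the choice of the type of the test modules does not matter.\<close>

theorem injective_module_any_universe:
  fixes R :: "('a, 'r) ring_scheme" and Q :: "('a, 'b, 'm) module_scheme"
  assumes inj: "injective_module TYPE('a) R Q"
  shows "injective_module TYPE('u) R Q"
proof -
  interpret Q: right_module R Q using inj by (simp add: injective_module_def)
  have ringR: "ring R" by (rule Q.R.ring_axioms)
  have "\<exists>g\<in>module_hom R N Q. \<forall>x\<in>M. g x = f x"
    if N: "right_module R N" and M: "submodule M R N" and f: "f \<in> module_hom R (N\<lparr>carrier := M\<rparr>) Q"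
    for N :: "('a, 'u) module" and M f
  proof -
    interpret N: right_module R N by fact
    interpret M: submodule M R N by fact
    have MN: "x \<in> carrier N" if "x \<in> M" for x using M.subset that by auto
    have M_add: "x \<oplus>\<^bsub>N\<^esub> y \<in> M" if "x \<in> M" "y \<in> M" for x y using M.m_closed that by auto
    have f_add: "f (x \<oplus>\<^bsub>N\<^esub> y) = f x \<oplus>\<^bsub>Q\<^esub> f y" if "x \<in> M" "y \<in> M" for x y
      using f that by (auto simp: module_hom_def)
    have f_smult: "f (r \<odot>\<^bsub>N\<^esub> x) = r \<odot>\<^bsub>Q\<^esub> f x" if "r \<in> carrier R" "x \<in> M" for r x
      using f that by (auto simp: module_hom_def)
    have f_closed: "f x \<in> carrier Q" if "x \<in> M" for x
      using f that by (auto simp: module_hom_def)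
    define graph where "graph = (\<lambda>x. (x, f x)) ` M"
    define E where "E = {G. G \<subseteq> carrier N \<times> carrier Q \<and> single_valued G \<and> graph \<subseteq> G \<and>
        (\<forall>x y x' y'. (x, y) \<in> G \<longrightarrow> (x', y') \<in> G \<longrightarrow> (x \<oplus>\<^bsub>N\<^esub> x', y \<oplus>\<^bsub>Q\<^esub> y') \<in> G) \<and>
        (\<forall>r x y. r \<in> carrier R \<longrightarrow> (x, y) \<in> G \<longrightarrow> (r \<odot>\<^bsub>N\<^esub> x, r \<odot>\<^bsub>Q\<^esub> y) \<in> G)}"
    have "graph \<in> E"
      unfolding E_def graph_def
      by (auto simp: single_valued_def MN M_add f_add f_smult f_closed image_iff)
    moreover have "\<Union>\<C> \<in> E" if ne: "\<C> \<noteq> {}" and chain: "subset.chain E \<C>" for \<C>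
    proof -
      have sub: "G \<in> E" if "G \<in> \<C>" for G
        using chain that by (auto simp: subset.chain_def)
      have join: "\<exists>G\<in>\<C>. p \<in> G \<and> q \<in> G" if p: "p \<in> \<Union>\<C>" and q: "q \<in> \<Union>\<C>" for p q
      proof -
        obtain G H where GH: "G \<in> \<C>" "p \<in> G" "H \<in> \<C>" "q \<in> H" using p q by (elim UnionE)
        then have "G \<subseteq> H \<or> H \<subseteq> G" using chain by (simp add: subset_chain_def)
        then show ?thesis using GH by (elim disjE) (auto dest: subsetD)
      qed
      have a1: "\<Union>\<C> \<subseteq> carrier N \<times> carrier Q"
      proof (rule Union_least)
        show "G \<subseteq> carrier N \<times> carrier Q" if "G \<in> \<C>" for G
          using sub[OF that] unfolding E_def by (elim CollectE conjE)
      qed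
      have a2: "graph \<subseteq> \<Union>\<C>"
      proof -
        obtain G where G: "G \<in> \<C>" using ne by auto
        have "graph \<subseteq> G" using sub[OF G] unfolding E_def by (elim CollectE conjE)
        with Union_upper[OF G] show ?thesis by (rule order_trans[rotated])
      qed
      have a3: "single_valued (\<Union>\<C>)"
      proof (rule single_valuedI)
        fix x y z assume "(x, y) \<in> \<Union>\<C>" "(x, z) \<in> \<Union>\<C>"
        from join[OF this] obtain G where G: "G \<in> \<C>" "(x, y) \<in> G" "(x, z) \<in> G" by (elim bexE conjE)
        have "single_valued G" using sub[OF G(1)] unfolding E_def by (elim CollectE conjE)
        then show "y = z" using G by (auto dest: single_valuedD)
      qed
      have a4: "(x \<oplus>\<^bsub>N\<^esub> x', y \<oplus>\<^bsub>Q\<^esub> y') \<in> \<Union>\<C>"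
        if p: "(x, y) \<in> \<Union>\<C>" and q: "(x', y') \<in> \<Union>\<C>" for x y x' y'
      proof -
        from join[OF p q] obtain G where G: "G \<in> \<C>" "(x, y) \<in> G" "(x', y') \<in> G" by (elim bexE conjE)
        have "(x \<oplus>\<^bsub>N\<^esub> x', y \<oplus>\<^bsub>Q\<^esub> y') \<in> G"
          using sub[OF G(1)] G unfolding E_def by simp
        with G(1) show ?thesis by (rule UnionI)
      qed
      have a5: "(r \<odot>\<^bsub>N\<^esub> x, r \<odot>\<^bsub>Q\<^esub> y) \<in> \<Union>\<C>"
        if r: "r \<in> carrier R" and p: "(x, y) \<in> \<Union>\<C>" for r x y
      proof -
        from p obtain G where G: "G \<in> \<C>" "(x, y) \<in> G" by (elim UnionE)
        have "(r \<odot>\<^bsub>N\<^esub> x, r \<odot>\<^bsub>Q\<^esub> y) \<in> G"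
          using sub[OF G(1)] G r unfolding E_def by simp
        with G(1) show ?thesis by (rule UnionI)
      qed
      show ?thesis
        unfolding E_def by (intro CollectI conjI allI impI a1 a2 a3 a4 a5)
    qed
    ultimately obtain G where GE: "G \<in> E" and max: "\<And>X. X \<in> E \<Longrightarrow> G \<subseteq> X \<Longrightarrow> X = G"
      using subset_Zorn_nonempty[of E] by force
    have G_N: "x \<in> carrier N" and G_Q: "y \<in> carrier Q" if "(x, y) \<in> G" for x y
      using GE that unfolding E_def by auto
    have G_sv: "y = z" if "(x, y) \<in> G" "(x, z) \<in> G" for x y z
      using GE that unfolding E_def single_valued_def by blast
    have G_graph: "(x, f x) \<in> G" if "x \<in> M" for x
      using GE that unfolding E_def graph_def by blast
    have G_add: "(x \<oplus>\<^bsub>N\<^esub> x', y \<oplus>\<^bsub>Q\<^esub> y') \<in> G" if "(x, y) \<in> G" "(x', y') \<in> G" for x y x' y'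
      using GE that unfolding E_def by blast
    have G_smult: "(r \<odot>\<^bsub>N\<^esub> x, r \<odot>\<^bsub>Q\<^esub> y) \<in> G" if "r \<in> carrier R" "(x, y) \<in> G" for r x y
      using GE that unfolding E_def by blast
    have G_zero: "(\<zero>\<^bsub>N\<^esub>, \<zero>\<^bsub>Q\<^esub>) \<in> G"
    proof -
      have "\<zero>\<^bsub>N\<^esub> \<in> M" using M.one_closed by simp
      from G_smult[OF Q.R.zero_closed G_graph[OF this]] show ?thesis
        using f_closed[OF \<open>\<zero>\<^bsub>N\<^esub> \<in> M\<close>] by (simp add: N.smult_l_null Q.smult_l_null)
    qed
    have G_minus: "(\<ominus>\<^bsub>N\<^esub> x, \<ominus>\<^bsub>Q\<^esub> y) \<in> G" if "(x, y) \<in> G" for x y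
      using G_smult[of "\<ominus>\<^bsub>R\<^esub> \<one>\<^bsub>R\<^esub>" x y] that G_N[OF that] G_Q[OF that]
      by (simp add: N.smult_minus_one Q.smult_minus_one)
    have total: "\<exists>y. (x, y) \<in> G" if x: "x \<in> carrier N" for x
    proof -
      define I where "I = {r \<in> carrier R. \<exists>y. (r \<odot>\<^bsub>N\<^esub> x, y) \<in> G}"
      define h where "h r = (THE y. (r \<odot>\<^bsub>N\<^esub> x, y) \<in> G)" for r
      have h_eq: "h r = y" if "(r \<odot>\<^bsub>N\<^esub> x, y) \<in> G" for r y
        unfolding h_def using that G_sv by (intro the_equality) blast+
      have h_G: "(r \<odot>\<^bsub>N\<^esub> x, h r) \<in> G" if "r \<in> I" for r
        using that h_eq unfolding I_def by fastforce
      have IR: "r \<in> carrier R" if "r \<in> I" for r using that by (simp add: I_def)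
      have h_plus: "((r \<oplus>\<^bsub>R\<^esub> s) \<odot>\<^bsub>N\<^esub> x, h r \<oplus>\<^bsub>Q\<^esub> h s) \<in> G" if "r \<in> I" "s \<in> I" for r s
        using G_add[OF h_G h_G, OF that] that x by (simp add: N.smult_l_distr IR)
      have h_times: "((r \<otimes>\<^bsub>R\<^esub> s) \<odot>\<^bsub>N\<^esub> x, s \<odot>\<^bsub>Q\<^esub> h r) \<in> G" if "r \<in> I" "s \<in> carrier R" for r s
        using G_smult[OF that(2) h_G[OF that(1)]] that x by (simp add: N.smult_assoc IR)
      interpret RR: right_module R "regular_module R"
        by (rule right_module_regular_module[OF ringR])
      have I: "submodule I R (regular_module R)"
      proof (rule RR.right_submoduleI)
        show "I \<subseteq> carrier (regular_module R)" by (auto simp: I_def regular_module_def)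
        show "\<zero>\<^bsub>regular_module R\<^esub> \<in> I"
          using G_zero x by (auto simp: I_def regular_module_def N.smult_l_null)
        show "r \<oplus>\<^bsub>regular_module R\<^esub> s \<in> I" if "r \<in> I" "s \<in> I" for r s
          using h_plus[OF that] that by (auto simp: I_def regular_module_def)
        show "s \<odot>\<^bsub>regular_module R\<^esub> r \<in> I" if "s \<in> carrier R" "r \<in> I" for r s
          using h_times[OF that(2,1)] that by (auto simp: I_def regular_module_def)
      qed
      have h: "h \<in> module_hom R ((regular_module R)\<lparr>carrier := I\<rparr>) Q"
        using h_eq[OF h_plus] h_eq[OF h_times] G_Q[OF h_G]
        by (simp add: module_hom_def regular_module_def)
      have "\<exists>g\<in>module_hom R (regular_module R) Q. \<forall>r\<in>I. g r = h r"
        using inj I h RR.right_module_axioms unfolding injective_module_def by simp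
      then obtain g where g: "g \<in> module_hom R (regular_module R) Q" and gh: "\<And>r. r \<in> I \<Longrightarrow> g r = h r"
        by blast
      have g_closed: "g r \<in> carrier Q" if "r \<in> carrier R" for r
        using g that by (auto simp: module_hom_def regular_module_def)
      have g_add: "g (r \<oplus>\<^bsub>R\<^esub> s) = g r \<oplus>\<^bsub>Q\<^esub> g s" if "r \<in> carrier R" "s \<in> carrier R" for r s
        using g that by (auto simp: module_hom_def regular_module_def)
      have g_mult: "g (r \<otimes>\<^bsub>R\<^esub> s) = s \<odot>\<^bsub>Q\<^esub> g r" if "r \<in> carrier R" "s \<in> carrier R" for r s
        using g that by (auto simp: module_hom_def regular_module_def)
      define G' where
        "G' = {(m \<oplus>\<^bsub>N\<^esub> r \<odot>\<^bsub>N\<^esub> x, y \<oplus>\<^bsub>Q\<^esub> g r) | m y r. (m, y) \<in> G \<and> r \<in> carrier R}"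
      have G'I: "(m \<oplus>\<^bsub>N\<^esub> r \<odot>\<^bsub>N\<^esub> x, y \<oplus>\<^bsub>Q\<^esub> g r) \<in> G'" if "(m, y) \<in> G" "r \<in> carrier R" for m y r
        using that unfolding G'_def by auto
      have g_zero: "g \<zero>\<^bsub>R\<^esub> = \<zero>\<^bsub>Q\<^esub>"
        using g_mult[of "\<zero>\<^bsub>R\<^esub>" "\<zero>\<^bsub>R\<^esub>"] g_closed[of "\<zero>\<^bsub>R\<^esub>"] by (simp add: Q.smult_l_null)
      have GG': "G \<subseteq> G'"
      proof (rule subrelI)
        fix m y assume my: "(m, y) \<in> G"
        from G'I[OF my Q.R.zero_closed] show "(m, y) \<in> G'"
          using G_N[OF my] G_Q[OF my] x by (simp add: g_zero N.smult_l_null)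
      qed
      have sv: "y \<oplus>\<^bsub>Q\<^esub> g r = y' \<oplus>\<^bsub>Q\<^esub> g r'"
        if my: "(m, y) \<in> G" and r: "r \<in> carrier R" and my': "(m', y') \<in> G" and r': "r' \<in> carrier R"
          and eq: "m \<oplus>\<^bsub>N\<^esub> r \<odot>\<^bsub>N\<^esub> x = m' \<oplus>\<^bsub>N\<^esub> r' \<odot>\<^bsub>N\<^esub> x" for m y r m' y' r'
      proof -
        note c = G_N[OF my] G_N[OF my'] G_Q[OF my] G_Q[OF my'] r r' x g_closed[OF r] g_closed[OF r']
        define s where "s = r \<oplus>\<^bsub>R\<^esub> \<ominus>\<^bsub>R\<^esub> r'"
        have s: "s \<in> carrier R" and rs: "r = s \<oplus>\<^bsub>R\<^esub> r'"
          using c by (auto simp: s_def Q.R.a_assoc Q.R.l_neg)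
        have "(m \<oplus>\<^bsub>N\<^esub> s \<odot>\<^bsub>N\<^esub> x) \<oplus>\<^bsub>N\<^esub> r' \<odot>\<^bsub>N\<^esub> x = m' \<oplus>\<^bsub>N\<^esub> r' \<odot>\<^bsub>N\<^esub> x"
          using eq c s unfolding rs by (simp add: N.smult_l_distr N.M.a_assoc)
        then have "m \<oplus>\<^bsub>N\<^esub> s \<odot>\<^bsub>N\<^esub> x = m'"
          using c s by simp
        then have "s \<odot>\<^bsub>N\<^esub> x = \<ominus>\<^bsub>N\<^esub> m \<oplus>\<^bsub>N\<^esub> m'"
          using c s N.M.r_neg1 by (metis N.smult_closed)
        then have sG: "(s \<odot>\<^bsub>N\<^esub> x, \<ominus>\<^bsub>Q\<^esub> y \<oplus>\<^bsub>Q\<^esub> y') \<in> G"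
          using G_add[OF G_minus[OF my] my'] by simp
        then have "g s = \<ominus>\<^bsub>Q\<^esub> y \<oplus>\<^bsub>Q\<^esub> y'"
          using gh[of s] h_eq[OF sG] s unfolding I_def by auto
        then have "y \<oplus>\<^bsub>Q\<^esub> g s = y'"
          using c by (simp add: Q.M.r_neg2)
        moreover have "y \<oplus>\<^bsub>Q\<^esub> g r = y \<oplus>\<^bsub>Q\<^esub> g s \<oplus>\<^bsub>Q\<^esub> g r'"
          using c s g_closed[OF s] g_add[OF s r'] rs by (simp add: Q.M.a_assoc)
        ultimately show ?thesis by simp
      qed
      have "G' \<in> E"
      proof -
        have b1: "G' \<subseteq> carrier N \<times> carrier Q"
          using G_N G_Q x g_closed unfolding G'_def by auto
        have b2: "single_valued G'"
        proof (rule single_valuedI)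
          fix p q q' assume pq: "(p, q) \<in> G'" and pq': "(p, q') \<in> G'"
          from pq obtain m y r where 1: "(m, y) \<in> G" "r \<in> carrier R"
              "p = m \<oplus>\<^bsub>N\<^esub> r \<odot>\<^bsub>N\<^esub> x" "q = y \<oplus>\<^bsub>Q\<^esub> g r"
            unfolding G'_def by auto
          from pq' obtain m' y' r' where 2: "(m', y') \<in> G" "r' \<in> carrier R"
              "p = m' \<oplus>\<^bsub>N\<^esub> r' \<odot>\<^bsub>N\<^esub> x" "q' = y' \<oplus>\<^bsub>Q\<^esub> g r'"
            unfolding G'_def by auto
          show "q = q'" using sv[OF 1(1,2) 2(1,2)] 1 2 by simp
        qed
        have b3: "graph \<subseteq> G'" using GG' GE unfolding E_def by (elim CollectE conjE) (rule order_trans)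
        have b4: "(p \<oplus>\<^bsub>N\<^esub> p', q \<oplus>\<^bsub>Q\<^esub> q') \<in> G'" if pq: "(p, q) \<in> G'" and pq': "(p', q') \<in> G'" for p q p' q'
        proof -
          from pq obtain m y r where 1: "(m, y) \<in> G" "r \<in> carrier R"
              "p = m \<oplus>\<^bsub>N\<^esub> r \<odot>\<^bsub>N\<^esub> x" "q = y \<oplus>\<^bsub>Q\<^esub> g r"
            unfolding G'_def by auto
          from pq' obtain m' y' r' where 2: "(m', y') \<in> G" "r' \<in> carrier R"
              "p' = m' \<oplus>\<^bsub>N\<^esub> r' \<odot>\<^bsub>N\<^esub> x" "q' = y' \<oplus>\<^bsub>Q\<^esub> g r'"
            unfolding G'_def by auto
          note c = G_N[OF 1(1)] G_N[OF 2(1)] G_Q[OF 1(1)] G_Q[OF 2(1)] 1(2) 2(2) x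
            g_closed[OF 1(2)] g_closed[OF 2(2)]
          have "p \<oplus>\<^bsub>N\<^esub> p' = (m \<oplus>\<^bsub>N\<^esub> m') \<oplus>\<^bsub>N\<^esub> (r \<oplus>\<^bsub>R\<^esub> r') \<odot>\<^bsub>N\<^esub> x"
            using c 1 2 by (simp add: N.smult_l_distr N.M.a_ac)
          moreover have "q \<oplus>\<^bsub>Q\<^esub> q' = (y \<oplus>\<^bsub>Q\<^esub> y') \<oplus>\<^bsub>Q\<^esub> g (r \<oplus>\<^bsub>R\<^esub> r')"
            using c 1 2 by (simp add: g_add Q.M.a_ac)
          ultimately show ?thesis
            using G'I[OF G_add[OF 1(1) 2(1)], of "r \<oplus>\<^bsub>R\<^esub> r'"] 1 2 by simp
        qed
        have b5: "(s \<odot>\<^bsub>N\<^esub> p, s \<odot>\<^bsub>Q\<^esub> q) \<in> G'" if s: "s \<in> carrier R" and pq: "(p, q) \<in> G'" for s p q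
        proof -
          from pq obtain m y r where 1: "(m, y) \<in> G" "r \<in> carrier R"
              "p = m \<oplus>\<^bsub>N\<^esub> r \<odot>\<^bsub>N\<^esub> x" "q = y \<oplus>\<^bsub>Q\<^esub> g r"
            unfolding G'_def by auto
          note c = G_N[OF 1(1)] G_Q[OF 1(1)] 1(2) x g_closed[OF 1(2)] s
          have "s \<odot>\<^bsub>N\<^esub> p = s \<odot>\<^bsub>N\<^esub> m \<oplus>\<^bsub>N\<^esub> (r \<otimes>\<^bsub>R\<^esub> s) \<odot>\<^bsub>N\<^esub> x"
            using c 1 by (simp add: N.smult_r_distr N.smult_assoc)
          moreover have "s \<odot>\<^bsub>Q\<^esub> q = s \<odot>\<^bsub>Q\<^esub> y \<oplus>\<^bsub>Q\<^esub> g (r \<otimes>\<^bsub>R\<^esub> s)"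
            using c 1 by (simp add: Q.smult_r_distr g_mult)
          ultimately show ?thesis
            using G'I[OF G_smult[OF s 1(1)], of "r \<otimes>\<^bsub>R\<^esub> s"] 1 s by simp
        qed
        show ?thesis
          unfolding E_def by (intro CollectI conjI allI impI b1 b2 b3 b4 b5)
      qed
      with max GG' have "G' = G" by blast
      have "(\<zero>\<^bsub>N\<^esub> \<oplus>\<^bsub>N\<^esub> \<one>\<^bsub>R\<^esub> \<odot>\<^bsub>N\<^esub> x, \<zero>\<^bsub>Q\<^esub> \<oplus>\<^bsub>Q\<^esub> g \<one>\<^bsub>R\<^esub>) \<in> G'"
        by (rule G'I[OF G_zero Q.R.one_closed])
      with \<open>G' = G\<close> x show ?thesis by auto
    qed
    define F where "F x = (THE y. (x, y) \<in> G)" for x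
    have F_eq: "F x = y" if "(x, y) \<in> G" for x y
      unfolding F_def using that G_sv by (intro the_equality) blast+
    have F_G: "(x, F x) \<in> G" if "x \<in> carrier N" for x
      using total[OF that] F_eq by fastforce
    have "F \<in> module_hom R N Q"
      using G_Q[OF F_G] F_eq[OF G_add[OF F_G F_G]] F_eq[OF G_smult[OF _ F_G]]
      by (simp add: module_hom_def)
    moreover have "F x = f x" if "x \<in> M" for x
      using F_eq G_graph that by blast
    ultimately show ?thesis by blast
  qed
  then show ?thesis
    unfolding injective_module_def using Q.right_module_axioms by blast
qed

end

theory Submission
  imports Defs
begin

text \<open>
  If \<open>A\<close> is a complement of \<open>B\<close> and also essential, then \<open>A \<inter> B = 0\<close> forces \<open>B = 0\<close>; but the only
  submodule maximal with respect to meeting \<open>0\<close> trivially is the whole module.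
\<close>

lemma submodule_zero_closed:
  assumes "submodule N R M"
  shows "\<zero>\<^bsub>M\<^esub> \<in> N"
  using subgroup.one_closed[OF submodule.axioms(1)[OF assms]] by simp

lemma submodule_subset_carrier:
  assumes "submodule N R M"
  shows "N \<subseteq> carrier M"
  using subgroup.subset[OF submodule.axioms(1)[OF assms]] by simp

context right_module
begin

lemma submodule_carrier: "submodule (carrier M) R M"
  by (rule right_submoduleI) auto

lemma submodule_zero: "submodule {\<zero>\<^bsub>M\<^esub>} R M"
proof (rule right_submoduleI)
  \<comment> \<open>Distributing \<open>r\<close> over \<open>0 + 0 = 0\<close> gives
    \<open>r0 + r0 = r0\<close>, and cancellation leaves \<open>r0 = 0\<close>.\<close>
  show "r \<odot>\<^bsub>M\<^esub> x \<in> {\<zero>\<^bsub>M\<^esub>}" if "r \<in> carrier R" "x \<in> {\<zero>\<^bsub>M\<^esub>}" for r x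
    using that smult_r_distr[of r "\<zero>\<^bsub>M\<^esub>" "\<zero>\<^bsub>M\<^esub>"] M.add.l_cancel_one
    by (metis M.l_zero M.zero_closed singleton_iff smult_closed)
qed auto

lemma essential_carrier: "essential_submodule R M (carrier M)"
  unfolding essential_submodule_def
  using submodule_carrier submodule_subset_carrier by (metis inf.absorb2)

text \<open>Every submodule contains \<open>0\<close>, so the conditions on \<open>{0}\<close> other
  than maximality hold automatically. Maximality says that a submodule meeting \<open>A\<close>
  trivially is zero, the contrapositive of essentiality.\<close>

lemma essential_iff_zero_complement:
  assumes "submodule A R M"
  shows "essential_submodule R M A \<longleftrightarrow> complement_submodule R M A {\<zero>\<^bsub>M\<^esub>}"
  using assms submodule_zero
  by (auto simp: essential_submodule_def complement_submodule_def
      dest: submodule_zero_closed)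

lemma closed_essential_eq_carrier:
  assumes "closed_submodule R M A" "essential_submodule R M A"
  shows "A = carrier M"
proof -
  obtain B where B: "submodule B R M" "B \<inter> A = {\<zero>\<^bsub>M\<^esub>}"
    and max: "\<And>N. \<lbrakk>submodule N R M; B \<inter> N = {\<zero>\<^bsub>M\<^esub>}; A \<subseteq> N\<rbrakk> \<Longrightarrow> N = A"
    using assms(1) unfolding closed_submodule_def complement_submodule_def by blast
  have "B = {\<zero>\<^bsub>M\<^esub>}"
    using assms(2) B unfolding essential_submodule_def by (metis inf_commute)
  moreover have "A \<subseteq> carrier M"
    using assms(2) submodule_subset_carrier unfolding essential_submodule_def by blast
  ultimately show ?thesis
    \<comment> \<open>Since \<open>B = 0\<close>, the whole module also meets \<open>B\<close>
      trivially, so maximality of \<open>A\<close> applies with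
      \<open>N = carrier M\<close>.\<close>
    using max[OF submodule_carrier] by simp
qed

end

theorem theorem4p11:
  fixes R :: "('a, 'm) ring_scheme" and n :: nat and C D :: "(nat \<Rightarrow> 'a) set"
  assumes "finite_frobenius_ring R"
    and "n > 0"
    and "linear_code R n C" and "linear_code R n D"
    and "independent_submodules (free_module R n) C D"
    and "closed_submodule R (free_module R n) (C <+>\<^bsub>free_module R n\<^esub> D)"
  shows "(LCP R n C D \<longleftrightarrow>
            essential_submodule R (free_module R n) (C <+>\<^bsub>free_module R n\<^esub> D)) \<and>
         (essential_submodule R (free_module R n) (C <+>\<^bsub>free_module R n\<^esub> D) \<longleftrightarrow>
            complement_submodule R (free_module R n) (C <+>\<^bsub>free_module R n\<^esub> D)
              {\<zero>\<^bsub>free_module R n\<^esub>})"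
proof -
  let ?M = "free_module R n"
  let ?A = "C <+>\<^bsub>?M\<^esub> D"
  interpret right_module R ?M
    using assms(1) by (intro right_module_free_module) (simp add: finite_frobenius_ring_def)
  \<comment> \<open>Being a complement includes being a submodule, so closedness supplies
    this.\<close>
  have "submodule ?A R ?M"
    using assms(6) unfolding closed_submodule_def complement_submodule_def by blast
  \<comment> \<open>With independence given, LCP reduces to \<open>?A = carrier ?M\<close>. Left to
    right, the whole module is essential in itself; the converse uses closedness.\<close>
  moreover have "LCP R n C D \<longleftrightarrow> essential_submodule R ?M ?A"
    using assms(5,6) essential_carrier closed_essential_eq_carrier unfolding LCP_def by metis
  ultimately show ?thesis
    using essential_iff_zero_complement by blast
qed

end
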